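(* Let $\alpha>0$ and $s>1$ be real numbers, and set \[ A:=\left(\frac{\alpha}{\alpha+1}\right)^s,\qquad B:=\left(\frac{\alpha}{\alpha+2}\right)^s,\qquad v:=B-A^2 . \] Then \[ \alpha^s\zeta(s,\alpha)\ >\ \frac{A^2+A-B}{A-B}\ >\ \frac{1}{1-A-v/2}, \] where both denominators $A-B$ and $1-A-v/2$ are positive.
   Context: Here $\zeta(s,\alpha)=\sum_{n\ge0}(n+\alpha)^{-s}$ denotes the Hurwitz zeta function, for real $s>1$ and $\alpha>0$. *)

theory Defs
  imports "HOL-Analysis.Analysis"
begin

(* Meaningful for s > 1 and a > 0, where the series converges. *)
definition hurwitz_zeta :: "real \<Rightarrow> real \<Rightarrow> real" where
  "hurwitz_zeta s a = (\<Sum>n. (real n + a) powr (- s))"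

end

theory Submission
  imports Defs
begin

text \<open>
  Writing \<open>a\<^sub>n = (\<alpha> / (\<alpha> + n))\<^sup>s\<close>, the ratios \<open>a\<^sub>n\<^sub>+\<^sub>1 / a\<^sub>n\<close> increase strictly with \<open>n\<close>, so
  \<open>\<alpha>\<^sup>s \<zeta>(s, \<alpha>) = \<Sum> a\<^sub>n\<close> exceeds \<open>1\<close> plus the geometric series with first term \<open>a\<^sub>1 = A\<close> and ratio
  \<open>B / A\<close>, which is \<open>1 + A\<^sup>2 / (A - B)\<close>. The second inequality is algebraic: after clearing
  denominators the two sides differ by \<open>v (A + v) / 2\<close>, and \<open>v > 0\<close>.
\<close>

text \<open>Iterating \<open>step\<close> bounds \<open>f\<close> termwise below by the geometric
  sequence; the one strict step keeps the sums apart.\<close>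

lemma suminf_gt_geometric:
  fixes f :: "nat \<Rightarrow> real"
  assumes sm: "summable f" and r: "0 \<le> r" "r < 1"
    and step: "\<And>n. f (Suc n) \<ge> f n * r" and strict: "f (Suc k) > f k * r"
  shows "suminf f > f 0 / (1 - r)"
proof -
  have ge: "f n \<ge> f 0 * r ^ n" for n
  proof (induction n)
    case (Suc n)
    have "f 0 * r ^ Suc n \<le> f n * r"
      using mult_right_mono[OF Suc r(1)] by (simp add: mult_ac)
    with step[of n] show ?case by linarith
  qed simp
  have gt: "f (Suc k) > f 0 * r ^ Suc k"
    using mult_right_mono[OF ge[of k] r(1)] strict by (simp add: mult_ac)
  have geo: "summable (\<lambda>n. f 0 * r ^ n)"
    using r by (intro summable_mult summable_geometric) auto
  have "0 < (\<Sum>n. f n - f 0 * r ^ n)"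
    using ge gt by (intro suminf_pos2[of _ "Suc k"] summable_diff sm geo) auto
  also have "\<dots> = suminf f - (\<Sum>n. f 0 * r ^ n)"
    using suminf_diff[OF sm geo] by simp
  also have "(\<Sum>n. f 0 * r ^ n) = f 0 / (1 - r)"
    using r by (simp add: suminf_mult summable_geometric suminf_geometric)
  finally show ?thesis by simp
qed

lemma summable_hurwitz_zeta:
  fixes s a :: real
  assumes "s > 1" "a \<ge> 0"
  shows "summable (\<lambda>n. (real n + a) powr (- s))"
proof (rule summable_comparison_test')
  show "summable (\<lambda>n. real n powr (- s))"
    using assms by (simp add: summable_real_powr_iff)
  \<comment> \<open>Index 0 is left out: \<open>0 powr (- s)\<close> is 0 and cannot dominate
    \<open>a powr (- s)\<close> when \<open>a > 0\<close>.\<close>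
  show "norm ((real n + a) powr (- s)) \<le> real n powr (- s)" if "n \<ge> 1" for n
    using that assms by (simp add: powr_mono2')
qed

theorem mainTheorem2:
  fixes \<alpha> s A B v :: real
  assumes "\<alpha> > 0" and "s > 1"
    and "A = (\<alpha> / (\<alpha> + 1)) powr s"
    and "B = (\<alpha> / (\<alpha> + 2)) powr s"
    and "v = B - A\<^sup>2"
  shows "A - B > 0 \<and> 1 - A - v / 2 > 0 \<and>
    \<alpha> powr s * hurwitz_zeta s \<alpha> > (A\<^sup>2 + A - B) / (A - B) \<and>
    (A\<^sup>2 + A - B) / (A - B) > 1 / (1 - A - v / 2)"
proof -
  define f where "f n = (\<alpha> / (\<alpha> + real n)) powr s" for n
  define r where "r = ((\<alpha> + 1) / (\<alpha> + 2)) powr s"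
  have A0: "A > 0" using assms by simp
  have BA: "B < A"
    unfolding assms(3,4) using assms(1,2) by (intro powr_less_mono2) (auto simp: field_simps)
  have "A < 1 powr s"
    unfolding assms(3) using assms(1,2) by (intro powr_less_mono2) auto
  hence A1: "A < 1" by simp
  \<comment> \<open>Both sides are powers with exponent \<open>s\<close>, so comparing bases
    suffices; that comes down to \<alpha>(\<alpha> + 2) < (\<alpha> + 1)^2.\<close>
  have "A\<^sup>2 = ((\<alpha> / (\<alpha> + 1))\<^sup>2) powr s"
    using assms(1) unfolding assms(3) power2_eq_square by (subst powr_mult) auto
  also have "\<dots> < B"
  proof -
    have "\<alpha> * (\<alpha> * (\<alpha> + 2)) < \<alpha> * (\<alpha> + 1)\<^sup>2"
      using assms(1) by (intro mult_strict_left_mono) (auto simp: algebra_simps power2_eq_square)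
    hence "(\<alpha> / (\<alpha> + 1))\<^sup>2 < \<alpha> / (\<alpha> + 2)"
      using assms(1) by (simp add: power_divide frac_less_eq divide_less_eq less_divide_eq
        power2_eq_square mult_ac)
    thus ?thesis
      unfolding assms(4) using assms(2) by (intro powr_less_mono2) auto
  qed
  finally have v: "v > 0" using assms(5) by simp
  \<comment> \<open>Twice the denominator is 2 - 2A - B + A^2, which exceeds this product because B
    < A.\<close>
  have "0 < (1 - A) * (2 - A)" using A1 by simp
  hence pos: "1 - A - v / 2 > 0"
    using BA unfolding assms(5) by (simp add: field_simps power2_eq_square)

  have r: "r = B / A" "0 \<le> r" "r < 1"
  proof -
    show "r = B / A"
      unfolding r_def assms(3,4) using assms(1)
      by (subst powr_divide[symmetric]) auto
    thus "r < 1" using BA A0 by simp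
  qed (simp add: r_def)
  have ratio: "f (Suc n) = f n * ((\<alpha> + real n) / (\<alpha> + real n + 1)) powr s" for n
    unfolding f_def using assms(1) by (subst powr_mult[symmetric]) (auto simp: add_ac)
  have step: "f (Suc (Suc n)) \<ge> f (Suc n) * r" for n
    unfolding ratio[of "Suc n"] r_def using assms(1,2)
    by (intro mult_left_mono powr_mono2) (auto simp: f_def field_simps)
  \<comment> \<open>Since \<open>r\<close> is itself the ratio of \<open>f 2\<close> to
    \<open>f 1\<close>, \<open>step\<close> is an equality at 0; the first strict case is the next
    one.\<close>
  have strict: "f (Suc (Suc 1)) > f (Suc 1) * r"
    unfolding ratio[of "Suc 1"] r_def using assms(1,2)
    by (intro mult_strict_left_mono powr_less_mono2) (auto simp: f_def field_simps)
  have f_eq: "f n = \<alpha> powr s * (real n + \<alpha>) powr (- s)" for n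
    using assms(1) by (simp add: f_def powr_divide powr_minus_divide add_ac)
  have sm: "summable f"
    unfolding f_eq using assms(1,2) by (intro summable_mult summable_hurwitz_zeta) auto
  have "\<alpha> powr s * hurwitz_zeta s \<alpha> = suminf f"
    unfolding hurwitz_zeta_def f_eq using assms(1,2)
    by (intro suminf_mult[symmetric] summable_hurwitz_zeta) auto
  \<comment> \<open>Comparing from \<open>f 0\<close> on, with first ratio A, would only give 1/(1 -
    A), which is too small as v > 0.\<close>
  also have "\<dots> = 1 + (\<Sum>n. f (Suc n))"
    using suminf_split_head[OF sm] assms(1) by (simp add: f_def)
  also have "\<dots> > 1 + f (Suc 0) / (1 - r)"
    using suminf_gt_geometric[of "\<lambda>n. f (Suc n)" r 1] sm r(2,3) step strict
    by (simp add: summable_Suc_iff)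
  also have "f (Suc 0) = A" by (simp add: f_def assms(3))
  also have "1 + A / (1 - r) = (A\<^sup>2 + A - B) / (A - B)"
    using A0 BA unfolding r(1) by (simp add: field_simps power2_eq_square)
  finally have zeta: "\<alpha> powr s * hurwitz_zeta s \<alpha> > (A\<^sup>2 + A - B) / (A - B)" .

  \<comment> \<open>In terms of v, the numerator is A - v and A - B is A - v - A^2.\<close>
  have "(A\<^sup>2 + A - B) * (1 - A - v / 2) - (A - B) = v * (A + v) / 2"
    unfolding assms(5) by (simp add: field_simps power2_eq_square)
  also have "\<dots> > 0" using v A0 by simp
  finally have "(A\<^sup>2 + A - B) / (A - B) > 1 / (1 - A - v / 2)"
    using pos BA by (simp add: divide_simps)
  with zeta pos BA show ?thesis by simp
qed

end
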